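(* Let $\alpha\ge 0$ be a real number and let $q(x)=c_0+c_1x+\cdots+c_rx^r$ ($r\ge 1$, $c_r\ne 0$) be a real polynomial with only real zeros. Suppose a simple set of real polynomials $B=\{b_k(x)\}_{k=0}^\infty$ satisfies $$\gamma_n b_n(x)=q(x)b_n^{(r)}(x)+\alpha q'(x)b_n^{(r-1)}(x)\qquad(n=0,1,2,\dots),$$ where $\{\gamma_n\}_{n=0}^\infty$ is a sequence of real numbers. Then $$\gamma_n=c_r\,\frac{n!\,\big(n+(\alpha-1)r+1\big)}{(n-r+1)!}\qquad(n=0,1,2,\dots),$$ where the right-hand side is interpreted as $0$ when $n<r-1$, and $\{\gamma_n\}_{n=0}^\infty$ is a $B$-CZDS.
   Context: A simple set of polynomials is a sequence $\{b_k(x)\}_{k=0}^\infty$ with $\deg b_k=k$ for all $k$ (hence a basis of $\mathbb{R}[x]$ if the $b_k$ are real). $b_n^{(j)}$ denotes the $j$-th derivative of $b_n$. For a non-zero function $f$, $Z_C(f)$ denotes the number of non-real zeros of $f$ in $\mathbb{C}$, counted according to multiplicity; for the identically zero function, $Z_C(0)=0$. A sequence of real numbers $\{\gamma_k\}_{k=0}^\infty$ is a complex zero decreasing sequence for the basis $B=\{b_k\}_{k=0}^\infty$ (a $B$-CZDS) if the linear operator $L:\mathbb{R}[x]\to\mathbb{R}[x]$ determined by $L(b_k)=\gamma_k b_k$ ($k=0,1,2,\dots$) satisfies $Z_C(L(p))\le Z_C(p)$ for every real polynomial $p$. *)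

theory Defs
  imports Complex_Main "HOL-Computational_Algebra.Polynomial"
begin

text \<open>The condition \<open>b k \<noteq> 0\<close> only matters for \<open>k = 0\<close>: here \<open>degree 0 = 0\<close>, whereas
  a polynomial of degree zero is meant to be a non-zero constant.\<close>

definition simple_set :: "(nat \<Rightarrow> real poly) \<Rightarrow> bool" where
  "simple_set b \<longleftrightarrow> (\<forall>k. b k \<noteq> 0 \<and> degree (b k) = k)"

definition real_rooted :: "real poly \<Rightarrow> bool" where
  "real_rooted p \<longleftrightarrow> (\<forall>z. poly (map_poly complex_of_real p) z = 0 \<longrightarrow> z \<in> \<real>)"

definition Z_C :: "real poly \<Rightarrow> nat" where
  "Z_C p = (if p = 0 then 0 else
     (\<Sum>z | poly (map_poly complex_of_real p) z = 0 \<and> z \<notin> \<real>.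
        order z (map_poly complex_of_real p)))"

text \<open>If \<open>b\<close> is a basis of the real polynomials (in particular, if it is a simple set), there is
  exactly one linear \<open>L\<close> with \<open>L (b k) = smult (\<gamma> k) (b k)\<close> for all \<open>k\<close>, so the existential
  quantifier speaks about that operator.\<close>

definition CZDS :: "(nat \<Rightarrow> real poly) \<Rightarrow> (nat \<Rightarrow> real) \<Rightarrow> bool" where
  "CZDS b \<gamma> \<longleftrightarrow>
     (\<exists>L :: real poly \<Rightarrow> real poly. Vector_Spaces.linear smult smult L \<and>
        (\<forall>k. L (b k) = smult (\<gamma> k) (b k)) \<and>
        (\<forall>p. Z_C (L p) \<le> Z_C p))"

end

theory Submission
  imports Defs "HOL-Computational_Algebra.Fundamental_Theorem_Algebra"
begin

text \<open>The right-hand side of the hypothesis is linear in \<open>b n\<close>, so the operator in question is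
  \<open>L p = q g' + \<alpha> q' g\<close> with \<open>g = p\<^sup>(\<^sup>r\<^sup>-\<^sup>1\<^sup>)\<close>. The eigenvalues come from comparing the
  coefficients of \<open>x\<^sup>n\<close> in \<open>L (b n) = \<gamma> n b n\<close>.

  For \<open>\<alpha> > 0\<close> the polynomial \<open>f = q g' + \<alpha> q' g\<close> is, up to the factor \<open>q / \<bar>q\<bar>\<^sup>\<alpha>\<close>, the derivative of
  \<open>\<bar>q\<bar>\<^sup>\<alpha> g\<close>. This function vanishes at every real zero of \<open>q g\<close>, so Rolle's theorem gives a zero
  of \<open>f\<close> strictly between any two neighbouring zeros; moreover a zero of \<open>q g\<close> of multiplicity \<open>m\<close> is
  a zero of \<open>f\<close> of multiplicity at least \<open>m - 1\<close>. Hence \<open>f\<close>, unless it is zero, has, with multiplicity, at least as many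
  real zeros as \<open>q\<close> and \<open>g\<close> together, less one (\<open>size_proots_weighted_deriv\<close>). On the other
  hand the degree of \<open>f\<close> is at most the sum of their degrees, less one. As \<open>q\<close> has no non-real
  zeros, subtracting gives \<open>Z_C f \<le> Z_C g\<close>.

  With \<open>q = 1\<close> the same inequality says that differentiation does not increase \<open>Z_C\<close>. This takes
  care of the passage from \<open>p\<close> to \<open>g\<close>, and also of the case \<open>\<alpha> = 0\<close>, where \<open>f = q g'\<close> has the same
  non-real zeros as \<open>g'\<close>.\<close>

section \<open>Real and non-real zeros\<close>

lemma map_poly_of_real_mult:
  "map_poly complex_of_real (p * q) = map_poly complex_of_real p * map_poly complex_of_real q"
  by (rule poly_eqI) (simp add: coeff_map_poly coeff_mult)

lemma map_poly_of_real_power: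
  "map_poly complex_of_real (p ^ n) = map_poly complex_of_real p ^ n"
  by (induction n) (simp_all add: map_poly_of_real_mult)

lemma poly_map_poly_of_real:
  "poly (map_poly complex_of_real p) (complex_of_real x) = complex_of_real (poly p x)"
  by (simp add: poly_altdef degree_map_poly coeff_map_poly)

lemma order_map_poly_of_real:
  assumes "p \<noteq> 0"
  shows "order (complex_of_real x) (map_poly complex_of_real p) = order x p"
proof -
  obtain s where s: "p = [:-x, 1:] ^ order x p * s" "\<not> [:-x, 1:] dvd s"
    using order_decomp[OF assms] by blast
  let ?m = "map_poly complex_of_real"
  have "?m p = [:-complex_of_real x, 1:] ^ order x p * ?m s"
    by (subst s(1)) (simp add: map_poly_of_real_mult map_poly_of_real_power map_poly_pCons)
  moreover have "poly (?m s) (complex_of_real x) \<noteq> 0"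
    using s(2) by (simp add: poly_map_poly_of_real poly_eq_0_iff_dvd)
  moreover from this have "?m s \<noteq> 0" by auto
  ultimately show ?thesis
    by (simp add: order_mult order_power_n_n order_0I)
qed

lemma size_proots_eq_sum_order:
  assumes "p \<noteq> 0"
  shows "size (proots p) = (\<Sum>x | poly p x = 0. order x p)"
  using assms by (simp add: size_multiset_overloaded_eq)

text \<open>By the fundamental theorem of algebra the zeros in the complex plane number \<open>degree p\<close>; the
  real ones among them are the members of \<open>proots p\<close>, with unchanged multiplicities. Upper bounds for
  \<open>Z_C\<close> thus become lower bounds for the number of real zeros, where Rolle's theorem
  applies.\<close>

lemma Z_C_plus_size_proots:
  assumes "p \<noteq> 0"
  shows "Z_C p + size (proots p) = degree p"
proof -
  define P where "P = map_poly complex_of_real p"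
  have P: "P \<noteq> 0" using assms by (simp add: P_def map_poly_eq_0_iff)
  have fin: "finite {z. poly P z = 0}" by (rule poly_roots_finite[OF P])
  have "size (proots p) = (\<Sum>x | poly p x = 0. order (complex_of_real x) P)"
    unfolding size_proots_eq_sum_order[OF assms] P_def
    by (simp add: order_map_poly_of_real[OF assms])
  also have "\<dots> = (\<Sum>z \<in> complex_of_real ` {x. poly p x = 0}. order z P)"
    by (subst sum.reindex) (simp_all add: inj_on_def)
  also have "complex_of_real ` {x. poly p x = 0} = {z. poly P z = 0 \<and> z \<in> \<real>}"
    by (auto simp: P_def poly_map_poly_of_real elim!: Reals_cases)
  finally have "Z_C p + size (proots p)
      = (\<Sum>z | poly P z = 0 \<and> z \<notin> \<real>. order z P) + (\<Sum>z | poly P z = 0 \<and> z \<in> \<real>. order z P)"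
    using assms by (simp add: Z_C_def P_def)
  also have "\<dots> = (\<Sum>z \<in> {z. poly P z = 0 \<and> z \<notin> \<real>} \<union> {z. poly P z = 0 \<and> z \<in> \<real>}. order z P)"
    by (rule sum.union_disjoint[symmetric]) (auto intro: finite_subset[OF _ fin])
  also have "{z. poly P z = 0 \<and> z \<notin> \<real>} \<union> {z. poly P z = 0 \<and> z \<in> \<real>} = {z. poly P z = 0}"
    by auto
  also have "(\<Sum>z | poly P z = 0. order z P) = degree P"
    using size_proots_eq_sum_order[OF P] size_proots_complex[of P] by simp
  finally show ?thesis by (simp add: P_def degree_map_poly)
qed

lemma Z_C_mult:
  assumes "p \<noteq> 0" "q \<noteq> 0"
  shows "Z_C (p * q) = Z_C p + Z_C q"
  using Z_C_plus_size_proots[of p] Z_C_plus_size_proots[of q] Z_C_plus_size_proots[of "p * q"] assms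
  by (simp add: proots_mult degree_mult_eq)

lemma Z_C_real_rooted: "real_rooted p \<Longrightarrow> Z_C p = 0"
  unfolding Z_C_def real_rooted_def by (auto intro!: sum.neutral)

section \<open>A weighted form of Rolle's theorem\<close>

text \<open>Where \<open>q\<close> does not vanish, this is \<open>(\<bar>q\<bar>\<^sup>\<alpha> g)'\<close> multiplied by \<open>q / \<bar>q\<bar>\<^sup>\<alpha>\<close>.\<close>

definition weighted_deriv :: "real \<Rightarrow> real poly \<Rightarrow> real poly \<Rightarrow> real poly" where
  "weighted_deriv \<alpha> q g = q * pderiv g + smult \<alpha> (pderiv q * g)"

text \<open>Rolle's theorem for \<open>\<bar>q\<bar>\<^sup>\<alpha> g\<close>. As \<open>\<alpha>\<close> is positive, this function is continuous also where \<open>q\<close>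
  vanishes, and vanishes there itself; it need not be differentiable there, which is why \<open>q\<close>
  has to be non-zero inside the interval.\<close>

lemma weighted_Rolle:
  assumes "\<alpha> > 0" "a < b" and roots: "poly (q * g) a = 0" "poly (q * g) b = 0"
    and gap: "\<And>x. a < x \<Longrightarrow> x < b \<Longrightarrow> poly q x \<noteq> 0"
  shows "\<exists>x. a < x \<and> x < b \<and> poly (weighted_deriv \<alpha> q g) x = 0"
proof -
  \<comment> \<open>\<open>w\<close> is \<open>\<bar>q\<bar>\<^sup>\<alpha>\<close>; the square spares a distinction by the sign of \<open>q\<close>.\<close>
  define w where "w x = ((poly q x)\<^sup>2) powr (\<alpha> / 2)" for x
  define F where "F x = w x * poly g x" for x
  define D where "D x = w x * poly (weighted_deriv \<alpha> q g) x / poly q x" for x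
  have "F a = F b"
    using roots by (auto simp: F_def w_def)
  moreover have "continuous_on {a..b} F"
    unfolding F_def w_def using \<open>\<alpha> > 0\<close>
    by (intro continuous_intros continuous_on_powr') auto
  moreover have DF: "(F has_real_derivative D x) (at x)" if "a < x" "x < b" for x
  proof -
    have nz: "poly q x \<noteq> 0" using gap that by blast
    have pos: "(poly q x)\<^sup>2 > 0" using nz by simp
    have "((poly q x)\<^sup>2) powr (\<alpha> / 2 - 1) = w x / (poly q x)\<^sup>2"
      using pos by (simp add: w_def powr_diff)
    then have w': "(w has_real_derivative w x * (\<alpha> * poly (pderiv q) x / poly q x)) (at x)"
      unfolding w_def using nz pos
      by (auto intro!: derivative_eq_intros simp: field_simps power2_eq_square)
    show ?thesis
      unfolding F_def D_def using nz
      by (auto intro!: derivative_eq_intros w' simp: field_simps weighted_deriv_def)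
  qed
  ultimately obtain x where x: "a < x" "x < b" "(\<lambda>t. D x * t) = (\<lambda>t. 0)"
    using Rolle_deriv[of a b F "\<lambda>x t. D x * t"] \<open>a < b\<close>
    by (auto simp: has_field_derivative_def)
  have "D x = 0" using fun_cong[OF x(3), of 1] by simp
  moreover have "poly q x \<noteq> 0" using gap x by blast
  ultimately show ?thesis using x by (auto simp: D_def w_def)
qed

text \<open>A set of \<open>n\<close> points has \<open>n - 1\<close> gaps, and the points chosen in them are distinct. That
  each point of \<open>B\<close> lies below some point of \<open>A\<close> is what keeps the induction going: when a new
  maximum is added to \<open>A\<close>, the point chosen in the last gap lies above all of \<open>B\<close>.\<close>

lemma points_in_gaps:
  fixes A :: "real set"
  assumes "finite A"
    and "\<And>a b. a \<in> A \<Longrightarrow> b \<in> A \<Longrightarrow> a < b \<Longrightarrow> {a<..<b} \<inter> A = {} \<Longrightarrow> \<exists>x. a < x \<and> x < b \<and> P x"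
  shows "\<exists>B. finite B \<and> B \<inter> A = {} \<and> (\<forall>x\<in>B. P x \<and> (\<exists>y\<in>A. x < y)) \<and> card A \<le> card B + 1"
  using assms
proof (induction A rule: finite_linorder_max_induct)
  case empty
  show ?case by (intro exI[of _ "{}"]) simp
next
  case (insert b A)
  show ?case
  proof (cases "A = {}")
    case True
    then show ?thesis by (intro exI[of _ "{}"]) simp
  next
    case False
    define a where "a = Max A"
    have a: "a \<in> A" "\<And>y. y \<in> A \<Longrightarrow> y \<le> a" using insert.hyps(1) False by (auto simp: a_def)
    have "\<exists>x. c < x \<and> x < d \<and> P x" if "c \<in> A" "d \<in> A" "c < d" "{c<..<d} \<inter> A = {}" for c d
      using insert.prems[of c d] insert.hyps(2) that by force
    then have "\<exists>B. finite B \<and> B \<inter> A = {} \<and> (\<forall>x\<in>B. P x \<and> (\<exists>y\<in>A. x < y)) \<and> card A \<le> card B + 1"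
      by (rule insert.IH)
    then obtain B where B: "finite B" "B \<inter> A = {}" "\<And>x. x \<in> B \<Longrightarrow> P x \<and> (\<exists>y\<in>A. x < y)"
        "card A \<le> card B + 1"
      by blast
    obtain x where x: "a < x" "x < b" "P x"
      using insert.prems[of a b] insert.hyps(2) a by force
    have "x \<notin> B" "b \<notin> B" using B(3) a(2) x insert.hyps(2) by fastforce+
    moreover have "x \<notin> A" using a(2) x(1) by force
    moreover have "b \<notin> A" using insert.hyps(2) by blast
    ultimately show ?thesis
      using B x insert.hyps(1) by (intro exI[of _ "insert x B"]) auto
  qed
qed

lemma power_dvd_pderiv:
  fixes h p :: "real poly"
  assumes "h ^ n dvd p"
  shows "h ^ (n - 1) dvd pderiv p"
proof (cases n)
  case (Suc k)
  then obtain s where "p = h ^ Suc k * s" using assms by (auto elim: dvdE)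
  then have "pderiv p = h ^ k * (h * pderiv s + smult (real (Suc k)) (s * pderiv h))"
    by (simp add: pderiv_mult pderiv_power_Suc distrib_left mult_ac del: power_Suc) simp
  then show ?thesis using Suc by simp
qed simp

text \<open>Each of the two summands has one factor differentiated, which costs at most one order of
  vanishing.\<close>

lemma order_weighted_deriv:
  assumes "weighted_deriv \<alpha> q g \<noteq> 0"
  shows "order x q + order x g \<le> order x (weighted_deriv \<alpha> q g) + 1"
proof -
  let ?h = "[:-x, 1:]" and ?m = "order x q" and ?k = "order x g"
  have "?h ^ (?m + (?k - 1)) dvd q * pderiv g" "?h ^ ((?m - 1) + ?k) dvd pderiv q * g"
    unfolding power_add by (intro mult_dvd_mono power_dvd_pderiv order_1)+
  moreover have "?m + ?k - 1 \<le> ?m + (?k - 1)" "?m + ?k - 1 \<le> (?m - 1) + ?k" by auto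
  ultimately have "?h ^ (?m + ?k - 1) dvd weighted_deriv \<alpha> q g"
    unfolding weighted_deriv_def by (meson dvd_add dvd_smult power_le_dvd)
  then show ?thesis using assms by (simp add: order_divides)
qed

text \<open>The zeros of \<open>q g\<close>, each with its multiplicity lowered by one, together with one Rolle zero from
  each gap between them, form a multiset of zeros of the weighted derivative. With \<open>k\<close>
  distinct zeros of \<open>q g\<close>, this loses \<open>k\<close> and regains at least \<open>k - 1\<close>.\<close>

lemma size_proots_weighted_deriv:
  assumes "\<alpha> > 0" and nz: "weighted_deriv \<alpha> q g \<noteq> 0"
  shows "size (proots q) + size (proots g) \<le> size (proots (weighted_deriv \<alpha> q g)) + 1"
proof -
  let ?f = "weighted_deriv \<alpha> q g"
  have qg: "q \<noteq> 0" "g \<noteq> 0" using nz by (auto simp: weighted_deriv_def)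
  define A where "A = {x. poly (q * g) x = 0}"
  have finA: "finite A" unfolding A_def by (rule poly_roots_finite) (use qg in simp)
  have "\<exists>x. a < x \<and> x < b \<and> poly ?f x = 0"
    if "a \<in> A" "b \<in> A" "a < b" "{a<..<b} \<inter> A = {}" for a b
  proof (rule weighted_Rolle[OF \<open>\<alpha> > 0\<close> \<open>a < b\<close>])
    show "poly q x \<noteq> 0" if "a < x" "x < b" for x
      using \<open>{a<..<b} \<inter> A = {}\<close> that by (auto simp: A_def disjoint_iff)
  qed (use that in \<open>simp_all add: A_def\<close>)
  from points_in_gaps[OF finA this] obtain B where
    B: "finite B" "B \<inter> A = {}" "\<And>x. x \<in> B \<Longrightarrow> poly ?f x = 0" "card A \<le> card B + 1"
    by blast
  have sub: "mset_set A \<subseteq># proots (q * g)"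
    using qg finA by (auto simp: subseteq_mset_def count_mset_set' A_def order_mult order_root Suc_le_eq)
  have "proots (q * g) - mset_set A + mset_set B \<subseteq># proots ?f"
    unfolding subseteq_mset_def
  proof
    fix x
    show "count (proots (q * g) - mset_set A + mset_set B) x \<le> count (proots ?f) x"
    proof (cases "x \<in> A")
      case True
      then have "x \<notin> B" using B(2) by blast
      then show ?thesis
        using True finA qg nz order_weighted_deriv[OF nz, of x] by (simp add: order_mult)
    next
      case False
      then have "order x (q * g) = 0" by (auto simp: A_def intro!: order_0I)
      moreover have "x \<in> B \<Longrightarrow> order x ?f > 0" using B(3) nz by (simp add: order_gt_0_iff)
      ultimately show ?thesis
        using False finA B(1) qg nz by (cases "x \<in> B") auto
    qed
  qed
  from size_mset_mono[OF this]
  have "size (proots (q * g)) - card A + card B \<le> size (proots ?f)"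
    by (simp only: size_union size_Diff_submset[OF sub] size_mset_set)
  moreover have "size (proots (q * g)) = size (proots q) + size (proots g)"
    using qg by (simp add: proots_mult)
  ultimately show ?thesis using B(4) by linarith
qed

section \<open>Non-real zeros of weighted derivatives\<close>

lemma degree_weighted_deriv_less:
  assumes "weighted_deriv \<alpha> q g \<noteq> 0"
  shows "degree (weighted_deriv \<alpha> q g) < degree q + degree g"
proof -
  have "\<not> (pderiv q = 0 \<and> pderiv g = 0)"
    using assms by (auto simp: weighted_deriv_def)
  then have pos: "0 < degree q + degree g" by (auto simp: pderiv_eq_0_iff)
  have bound: "degree (u * pderiv v) < degree u + degree v"
    if "0 < degree u + degree v" for u v :: "real poly"
  proof (cases "degree v = 0")
    case True
    then have "pderiv v = 0" by (simp add: pderiv_eq_0_iff)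
    then show ?thesis using that by simp
  next
    case False
    then show ?thesis using degree_mult_le[of u "pderiv v"] by (simp add: degree_pderiv)
  qed
  have "degree (q * pderiv g) < degree q + degree g" "degree (pderiv q * g) < degree q + degree g"
    using bound[of q g] bound[of g q] pos by (simp_all add: mult.commute add.commute)
  then show ?thesis
    unfolding weighted_deriv_def
    by (intro degree_add_less le_less_trans[OF degree_smult_le])
qed

text \<open>Passing from \<open>q\<close> and \<open>g\<close> to their weighted derivative lowers the total degree by at least one and
  the total number of real zeros by at most one; all zeros of \<open>q\<close> are real, so only those of
  \<open>g\<close> remain to be accounted for.\<close>

lemma Z_C_weighted_deriv_pos:
  assumes "\<alpha> > 0" "real_rooted q"
  shows "Z_C (weighted_deriv \<alpha> q g) \<le> Z_C g"
proof (cases "weighted_deriv \<alpha> q g = 0")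
  case False
  then have qg: "q \<noteq> 0" "g \<noteq> 0" by (auto simp: weighted_deriv_def)
  show ?thesis
    using size_proots_weighted_deriv[OF \<open>\<alpha> > 0\<close> False] degree_weighted_deriv_less[OF False]
      Z_C_plus_size_proots[OF qg(1)] Z_C_plus_size_proots[OF qg(2)] Z_C_plus_size_proots[OF False]
      Z_C_real_rooted[OF assms(2)]
    by linarith
qed (simp add: Z_C_def)

text \<open>The weight \<open>q = 1\<close> turns the weighted derivative into the ordinary one.\<close>

lemma Z_C_pderiv_le: "Z_C (pderiv g) \<le> Z_C g"
  using Z_C_weighted_deriv_pos[of 1 1 g] by (simp add: weighted_deriv_def real_rooted_def)

lemma Z_C_higher_pderiv_le: "Z_C ((pderiv ^^ n) g) \<le> Z_C g"
  by (induction n) (auto intro: order_trans[OF Z_C_pderiv_le])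

lemma Z_C_weighted_deriv:
  assumes "\<alpha> \<ge> 0" "real_rooted q"
  shows "Z_C (weighted_deriv \<alpha> q g) \<le> Z_C g"
proof (cases "\<alpha> = 0")
  case True
  then have "Z_C (weighted_deriv \<alpha> q g) \<le> Z_C (pderiv g)"
    using Z_C_real_rooted[OF assms(2)]
    by (cases "q = 0 \<or> pderiv g = 0") (auto simp: weighted_deriv_def Z_C_mult Z_C_def[of 0])
  then show ?thesis using Z_C_pderiv_le[of g] by linarith
qed (use assms Z_C_weighted_deriv_pos in simp)

section \<open>The eigenvalues and the operator\<close>

text \<open>The index \<open>n\<close> is the degree that \<open>p g'\<close> generically has. If \<open>g\<close> is constant, then \<open>n\<close> is
  \<open>degree p - 1\<close> and both sides vanish, so that no case distinction is needed below.\<close>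

lemma coeff_mult_pderiv_right:
  fixes p g :: "real poly"
  assumes "degree p + degree g = Suc n"
  shows "coeff (p * pderiv g) n = lead_coeff p * (real (degree g) * lead_coeff g)"
proof (cases "degree g")
  case 0
  then have "pderiv g = 0" by (simp add: pderiv_eq_0_iff)
  then show ?thesis using 0 by simp
next
  case (Suc m)
  then have "n = degree p + degree (pderiv g)" using assms by (simp add: degree_pderiv)
  then have "coeff (p * pderiv g) n = lead_coeff p * lead_coeff (pderiv g)"
    by (simp only: coeff_mult_degree_sum)
  then show ?thesis
    using Suc by (simp add: degree_pderiv coeff_pderiv)
qed

lemma coeff_weighted_deriv:
  assumes "degree q + degree g = Suc n"
  shows "coeff (weighted_deriv \<alpha> q g) n
    = lead_coeff q * lead_coeff g * (real (degree g) + \<alpha> * real (degree q))"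
  using coeff_mult_pderiv_right[OF assms] coeff_mult_pderiv_right[of g q n] assms
  by (simp add: weighted_deriv_def algebra_simps)

lemma lead_coeff_higher_pderiv:
  fixes p :: "real poly"
  assumes "k \<le> degree p"
  shows "lead_coeff ((pderiv ^^ k) p) = fact (degree p) / fact (degree p - k) * lead_coeff p"
proof -
  have "(fact (degree p) :: real) = fact (degree p - k) * pochhammer (real (Suc (degree p - k))) k"
    using pochhammer_product'[of "1::real" "degree p - k" k] assms
    by (simp add: pochhammer_fact add_ac)
  then show ?thesis
    using assms by (simp add: degree_higher_pderiv coeff_higher_pderiv field_simps)
qed

lemma linear_weighted_deriv:
  "Vector_Spaces.linear smult smult (\<lambda>p. weighted_deriv \<alpha> q ((pderiv ^^ k) p))"
proof -
  have "vector_space (smult :: real \<Rightarrow> real poly \<Rightarrow> real poly)"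
    by unfold_locales (simp_all add: smult_add_right smult_add_left)
  then show ?thesis
    unfolding Vector_Spaces.linear_iff
    by (simp add: weighted_deriv_def higher_pderiv_add higher_pderiv_smult pderiv_add pderiv_smult
        smult_add_right algebra_simps)
qed

theorem theorem17:
  fixes \<alpha> :: real and q :: "real poly" and r :: nat
    and b :: "nat \<Rightarrow> real poly" and \<gamma> :: "nat \<Rightarrow> real"
  assumes "\<alpha> \<ge> 0"
    and "r \<ge> 1" and "degree q = r" and "real_rooted q"
    and "simple_set b"
    and "\<And>n. smult (\<gamma> n) (b n) =
           q * (pderiv ^^ r) (b n) + smult \<alpha> (pderiv q * (pderiv ^^ (r - 1)) (b n))"
  shows "(\<forall>n. \<gamma> n = (if n < r - 1 then 0
                    else coeff q r * (fact n * (real n + (\<alpha> - 1) * real r + 1) / fact (n + 1 - r))))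
         \<and> CZDS b \<gamma>"
proof (intro conjI allI)
  have "(pderiv ^^ r) p = pderiv ((pderiv ^^ (r - 1)) p)" for p :: "real poly"
    using \<open>r \<ge> 1\<close> by (cases r) simp_all
  then have eigen: "smult (\<gamma> n) (b n) = weighted_deriv \<alpha> q ((pderiv ^^ (r - 1)) (b n))" for n
    using assms(6) by (simp add: weighted_deriv_def)
  show "CZDS b \<gamma>"
    unfolding CZDS_def
  proof (intro exI conjI allI)
    show "Vector_Spaces.linear smult smult (\<lambda>p. weighted_deriv \<alpha> q ((pderiv ^^ (r - 1)) p))"
      by (rule linear_weighted_deriv)
    show "weighted_deriv \<alpha> q ((pderiv ^^ (r - 1)) (b k)) = smult (\<gamma> k) (b k)" for k
      by (simp add: eigen)
    show "Z_C (weighted_deriv \<alpha> q ((pderiv ^^ (r - 1)) p)) \<le> Z_C p" for p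
      using Z_C_weighted_deriv[OF \<open>\<alpha> \<ge> 0\<close> \<open>real_rooted q\<close>] Z_C_higher_pderiv_le
      by (rule order_trans)
  qed
  fix n
  have b: "b n \<noteq> 0" "degree (b n) = n" using \<open>simple_set b\<close> by (simp_all add: simple_set_def)
  define g where "g = (pderiv ^^ (r - 1)) (b n)"
  show "\<gamma> n = (if n < r - 1 then 0
      else coeff q r * (fact n * (real n + (\<alpha> - 1) * real r + 1) / fact (n + 1 - r)))"
  proof (cases "n < r - 1")
    case True
    then have "g = 0"
      unfolding g_def by (intro poly_eqI) (simp add: coeff_higher_pderiv coeff_eq_0 b)
    then show ?thesis
      using True eigen[of n, folded g_def] b by (simp add: weighted_deriv_def)
  next
    case False
    have deg_g: "degree g = n + 1 - r"
      using \<open>r \<ge> 1\<close> b by (simp add: g_def degree_higher_pderiv)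
    have lead_g: "lead_coeff g = fact n / fact (n + 1 - r) * lead_coeff (b n)"
      using False \<open>r \<ge> 1\<close> b lead_coeff_higher_pderiv[of "r - 1" "b n"] by (simp add: g_def)
    have "\<gamma> n * lead_coeff (b n) = coeff (weighted_deriv \<alpha> q g) n"
      using arg_cong[OF eigen[of n], of "\<lambda>p. coeff p n"] b by (simp add: g_def)
    also have "\<dots> = lead_coeff q * lead_coeff g * (real (degree g) + \<alpha> * real (degree q))"
      using False deg_g assms(2,3) by (intro coeff_weighted_deriv) simp
    also have "real (degree g) + \<alpha> * real (degree q) = real n + (\<alpha> - 1) * real r + 1"
      using False deg_g assms(2,3) by (simp add: of_nat_diff algebra_simps)
    finally have "\<gamma> n * lead_coeff (b n) =
        coeff q r * (fact n * (real n + (\<alpha> - 1) * real r + 1) / fact (n + 1 - r)) * lead_coeff (b n)"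
      using \<open>degree q = r\<close> lead_g by (simp add: mult_ac)
    moreover have "lead_coeff (b n) \<noteq> 0" using b(1) by (simp only: leading_coeff_0_iff not_False_eq_True)
    ultimately have "\<gamma> n = coeff q r * (fact n * (real n + (\<alpha> - 1) * real r + 1) / fact (n + 1 - r))"
      using mult_right_cancel by blast
    then show ?thesis using False by simp
  qed
qed

end
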